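(* Let $G$ be an $n$-vertex graph with minimum degree $d$. Then $$\alpha'_*(G) \ge \frac{n d^2}{\lambda_1(G)^2 + d^2},$$ with equality if and only if $k = \frac{n(\lambda_1(G)^2 - d^2)}{\lambda_1(G)^2 + d^2}$ is an integer and $G \in \mathcal{H}(d,k)$.
   Context: All graphs are finite and simple. $\lambda_1(G)$ denotes the largest eigenvalue of the adjacency matrix of $G$. A fractional matching of a graph $G$ is a function $f: E(G)\to[0,1]$ such that $\sum_{e\in\Gamma(v)} f(e)\le 1$ for every $v\in V(G)$, where $\Gamma(v)$ is the set of edges incident to $v$. The fractional matching number $\alpha'_*(G)$ is the maximum of $\sum_{e\in E(G)} f(e)$ over all fractional matchings $f$ of $G$. For positive integers $d,k$, $\mathcal{H}(d,k)$ denotes the family of connected bipartite graphs $H$ with bipartition $(A,B)$ such that (i) every vertex in $A$ has degree $d$, (ii) $|A| = |B| + k$, and (iii) all vertices in $B$ have the same degree.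
   Formalization: The equality characterization is proved only for connected G with k ≠ 0; as stated it is false: K_3 (k = 0, not bipartite) and two disjoint copies of the path P_3 (k = 2, not connected) attain equality but lie in no H(d,k). The inequality holds for all G. *)

theory Defs
  imports "HOL-Analysis.Analysis"
begin

text \<open>
  A graph on \<open>n\<close> vertices is given by its set \<open>E\<close> of edges, which are two-element sets of
  vertices; the vertex set is the whole finite type \<open>'v\<close>, so \<open>n = CARD('v)\<close>.
\<close>

definition simple_graph :: "'v::finite set set \<Rightarrow> bool" where
  "simple_graph E \<longleftrightarrow> (\<forall>e\<in>E. card e = 2)"

definition incident_edges :: "'v::finite set set \<Rightarrow> 'v \<Rightarrow> 'v set set" where
  "incident_edges E v = {e \<in> E. v \<in> e}"

definition degree :: "'v::finite set set \<Rightarrow> 'v \<Rightarrow> nat" where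
  "degree E v = card (incident_edges E v)"

definition min_degree :: "'v::finite set set \<Rightarrow> nat" where
  "min_degree E = Min (range (degree E))"

definition graph_connected :: "'v::finite set set \<Rightarrow> bool" where
  "graph_connected E \<longleftrightarrow> (\<forall>u v. (u, v) \<in> {(a, b). {a, b} \<in> E}\<^sup>*)"

definition adjacency_matrix :: "'v::finite set set \<Rightarrow> real^'v^'v" where
  "adjacency_matrix E = (\<chi> i j. if {i, j} \<in> E then 1 else 0)"

definition eigenvalues :: "real^'v^'v \<Rightarrow> real set" where
  "eigenvalues A = {c. \<exists>x. x \<noteq> 0 \<and> A *v x = c *\<^sub>R x}"

text \<open>
  Adjacency matrices are symmetric, so all their eigenvalues are real and they have at least one;
  the maximum is over a finite nonempty set.
\<close>

definition lambda1 :: "'v::finite set set \<Rightarrow> real" where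
  "lambda1 E = Max (eigenvalues (adjacency_matrix E))"

definition fractional_matching :: "'v::finite set set \<Rightarrow> ('v set \<Rightarrow> real) \<Rightarrow> bool" where
  "fractional_matching E f \<longleftrightarrow>
     (\<forall>e\<in>E. 0 \<le> f e \<and> f e \<le> 1) \<and> (\<forall>v. sum f (incident_edges E v) \<le> 1)"

text \<open>
  The supremum is a maximum, since the fractional matchings, restricted to \<open>E\<close>, form a
  compact polytope.
\<close>

definition fractional_matching_number :: "'v::finite set set \<Rightarrow> real" where
  "fractional_matching_number E = (SUP f \<in> {f. fractional_matching E f}. sum f E)"

definition bipartition :: "'v::finite set set \<Rightarrow> 'v set \<Rightarrow> 'v set \<Rightarrow> bool" where
  "bipartition E A B \<longleftrightarrow>
     A \<inter> B = {} \<and> A \<union> B = UNIV \<and> (\<forall>e\<in>E. \<exists>a\<in>A. \<exists>b\<in>B. e = {a, b})"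

text \<open>
  The family \<open>\<H>(d,k)\<close> is defined for positive \<open>d\<close> and \<open>k\<close> only; it is empty otherwise.
\<close>

definition H_family :: "nat \<Rightarrow> nat \<Rightarrow> 'v::finite set set set" where
  "H_family d k = {E. 0 < d \<and> 0 < k \<and> simple_graph E \<and> graph_connected E \<and>
     (\<exists>A B. bipartition E A B \<and>
        (\<forall>v\<in>A. degree E v = d) \<and>
        card A = card B + k \<and>
        (\<exists>r. \<forall>v\<in>B. degree E v = r))}"

end

theory Submission
  imports Defs
begin

text \<open>
  Let \<open>\<delta>\<close> be the maximum of \<open>|X| - |N(X)|\<close> over vertex sets \<open>X\<close>. The deficiency form of Hall's theorem,
  applied to the bipartite double cover, gives a fractional matching of size \<open>(n - \<delta>)/2\<close>, so no
  linear programming duality is needed. For an optimal \<open>X\<close>, the set \<open>T = X - N(X)\<close> is independent, its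
  neighbours lie in \<open>S = N(X) - X\<close>, and \<open>|T| = |S| + \<delta>\<close>. At least \<open>d|T|\<close> edges join \<open>T\<close> to \<open>S\<close>, whence
  \<open>d\<^sup>2|T| \<le> \<lambda>\<^sub>1\<^sup>2|S|\<close> by a Rayleigh quotient, and with \<open>|S| + |T| \<le> n\<close> the bound follows. Equality forces
  \<open>S\<close> and \<open>T\<close> to cover the graph and the test vector to be an eigenvector. Conversely the
  smaller side of a bipartite graph in \<open>\<H>(d,k)\<close> is a vertex cover of size \<open>(n - k)/2\<close>.
\<close>

section \<open>Hall's theorem with deficiency\<close>

text \<open>Rado's proof of Hall's theorem: if some \<open>A i\<close> has two elements, then by submodularity of
  \<open>J \<mapsto> |\<Union>(A ` J)|\<close> one of them can be removed without violating the condition.\<close>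
lemma rado_deficiency:
  fixes A :: "'i \<Rightarrow> 'a set" and \<delta> :: nat
  assumes "finite I" and "\<And>i. i \<in> I \<Longrightarrow> finite (A i)"
    and "\<And>J. J \<subseteq> I \<Longrightarrow> card J \<le> card (\<Union>(A ` J)) + \<delta>"
  shows "\<exists>R h. finite R \<and> card I \<le> card R + \<delta> \<and> inj_on h R \<and> (\<forall>r\<in>R. h r \<in> I \<and> r \<in> A (h r))"
  using assms(2,3)
proof (induction "\<Sum>i\<in>I. card (A i)" arbitrary: A rule: less_induct)
  case less
  note fin = less.prems(1) and hall = less.prems(2)
  have finU: "finite (\<Union>(A ` J))" if "J \<subseteq> I" for J
    using that fin \<open>finite I\<close> by (meson finite_UN finite_subset subsetD)
  show ?case
  proof (cases "\<exists>i\<in>I. \<exists>x\<in>A i. \<exists>y\<in>A i. x \<noteq> y")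
    case False
    \<comment> \<open>Every \<open>A i\<close> now has at most one element, so distinct elements of
      the union have distinct indices and any choice of index is injective.\<close>
    define R where "R = \<Union>(A ` I)"
    have "\<forall>r\<in>R. \<exists>i. i \<in> I \<and> r \<in> A i" by (auto simp: R_def)
    then obtain h where h: "\<forall>r\<in>R. h r \<in> I \<and> r \<in> A (h r)" by metis
    moreover have "inj_on h R" using h False by (intro inj_onI) metis
    ultimately show ?thesis using hall[of I] finU[of I] by (auto simp: R_def)
  next
    case True
    then obtain i x y where i: "i \<in> I" and xy: "x \<in> A i" "y \<in> A i" "x \<noteq> y" by blast
    \<comment> \<open>Removing \<open>z\<close> only affects index sets containing \<open>i\<close>,
      hence the form of \<open>ok\<close>. The \<open>R\<close> and \<open>h\<close> found for the
      smaller family also serve the original one.\<close>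
    have shrink: "?thesis" if z: "z \<in> A i"
      and ok: "\<And>J. J \<subseteq> I - {i} \<Longrightarrow> card (insert i J) \<le> card (\<Union>(A ` J) \<union> (A i - {z})) + \<delta>" for z
    proof -
      define A' where "A' = A(i := A i - {z})"
      have lt: "(\<Sum>j\<in>I. card (A' j)) < (\<Sum>j\<in>I. card (A j))"
      proof (rule sum_strict_mono_ex1[OF \<open>finite I\<close>])
        show "\<forall>j\<in>I. card (A' j) \<le> card (A j)"
          using fin by (auto simp: A'_def intro: card_mono)
        show "\<exists>j\<in>I. card (A' j) < card (A j)"
          using i z fin[OF i] by (intro bexI[of _ i]) (auto simp: A'_def intro!: card_Diff1_less simp del: card_Diff_insert)
      qed
      have fin': "finite (A' j)" if "j \<in> I" for j using fin[OF that] by (auto simp: A'_def)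
      have hall': "card J \<le> card (\<Union>(A' ` J)) + \<delta>" if J: "J \<subseteq> I" for J
      proof (cases "i \<in> J")
        case False
        then have "\<Union>(A' ` J) = \<Union>(A ` J)" by (auto simp: A'_def)
        then show ?thesis using hall[OF J] by simp
      next
        case True
        have "\<Union>(A' ` J) = \<Union>(A ` (J - {i})) \<union> (A i - {z})"
          using True by (auto simp: A'_def split: if_splits)
        moreover have "insert i (J - {i}) = J" using True by auto
        moreover have "J - {i} \<subseteq> I - {i}" using J by auto
        ultimately show ?thesis using ok[of "J - {i}"] by simp
      qed
      obtain R h where R: "finite R" "card I \<le> card R + \<delta>" "inj_on h R"
        "\<forall>r\<in>R. h r \<in> I \<and> r \<in> A' (h r)"
        using less.hyps[OF lt fin' hall'] by blast
      have "\<forall>r\<in>R. h r \<in> I \<and> r \<in> A (h r)"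
        using R(4) by (auto simp: A'_def split: if_splits)
      with R show ?thesis by blast
    qed
    show ?thesis
    proof (rule ccontr)
      assume neg: "\<not> ?thesis"
      obtain J where J: "J \<subseteq> I - {i}"
        and cJ: "card (\<Union>(A ` J) \<union> (A i - {x})) + \<delta> < card (insert i J)"
        using shrink[OF xy(1)] neg by (meson not_le)
      obtain K where K: "K \<subseteq> I - {i}"
        and cK: "card (\<Union>(A ` K) \<union> (A i - {y})) + \<delta> < card (insert i K)"
        using shrink[OF xy(2)] neg by (meson not_le)
      have finJK: "finite J" "finite K" using J K \<open>finite I\<close> by (meson finite_Diff finite_subset)+
      define P where "P = \<Union>(A ` J) \<union> (A i - {x})"
      define Q where "Q = \<Union>(A ` K) \<union> (A i - {y})"
      have finPQ: "finite P" "finite Q"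
        using finU[of J] finU[of K] J K fin[OF i] by (auto simp: P_def Q_def)
      \<comment> \<open>As \<open>x\<close> and \<open>y\<close> differ, each restores what the
        other removal took from \<open>A i\<close>. Hall's condition on
        \<open>insert i (J \<union> K)\<close> and \<open>J \<inter> K\<close> then gives
        \<open>|J| + |K| + 1 \<le> |P| + |Q| + 2\<delta>\<close>, while the two violations give
        \<open>|P| + |Q| + 2\<delta> \<le> |J| + |K|\<close>.\<close>
      have un: "P \<union> Q = \<Union>(A ` insert i (J \<union> K))" using xy by (auto simp: P_def Q_def)
      have int: "\<Union>(A ` (J \<inter> K)) \<subseteq> P \<inter> Q" by (auto simp: P_def Q_def)
      have "card (insert i (J \<union> K)) \<le> card (P \<union> Q) + \<delta>"
        unfolding un using J K i by (intro hall) auto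
      moreover have "card (J \<inter> K) \<le> card (P \<inter> Q) + \<delta>"
        using hall[of "J \<inter> K"] card_mono[OF _ int] J finPQ by force
      moreover have "card P + card Q = card (P \<union> Q) + card (P \<inter> Q)"
        using finPQ by (rule card_Un_Int)
      moreover have "card J + card K = card (J \<union> K) + card (J \<inter> K)"
        using finJK by (rule card_Un_Int)
      moreover have "card (insert i (J \<union> K)) = Suc (card (J \<union> K))"
        "card (insert i J) = Suc (card J)" "card (insert i K) = Suc (card K)"
        using J K finJK by (auto simp: card_insert_if)
      ultimately show False using cJ cK unfolding P_def[symmetric] Q_def[symmetric] by linarith
    qed
  qed
qed

section \<open>Rayleigh quotients of symmetric matrices\<close>

lemma symmetric_inner_matrix:
  fixes A :: "real^'n^'n"
  assumes "transpose A = A"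
  shows "x \<bullet> (A *v y) = (A *v x) \<bullet> y"
  using assms by (metis dot_lmul_matrix vector_transpose_matrix)

text \<open>Eigenvectors for distinct eigenvalues are orthogonal, hence independent. Finiteness is
  what makes \<open>Max\<close> an upper bound of the spectrum.\<close>

lemma finite_eigenvalues_symmetric:
  fixes A :: "real^'n^'n"
  assumes sym: "transpose A = A"
  shows "finite (eigenvalues A)"
proof -
  have "\<forall>c\<in>eigenvalues A. \<exists>x. x \<noteq> 0 \<and> A *v x = c *\<^sub>R x" by (simp add: eigenvalues_def)
  then obtain v where v: "\<And>c. c \<in> eigenvalues A \<Longrightarrow> v c \<noteq> 0 \<and> A *v v c = c *\<^sub>R v c"
    by metis
  have orth: "v c \<bullet> v c' = 0" if "c \<in> eigenvalues A" "c' \<in> eigenvalues A" "c \<noteq> c'" for c c'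
    using symmetric_inner_matrix[OF sym, of "v c" "v c'"] v that by auto
  have "inj_on v (eigenvalues A)"
    by (rule inj_onI) (metis orth v inner_eq_zero_iff)
  moreover have "independent (v ` eigenvalues A)"
    using v by (intro pairwise_orthogonal_independent)
      (auto simp: pairwise_def orthogonal_def intro: orth)
  ultimately show ?thesis
    using finiteI_independent finite_imageD by blast
qed

text \<open>First-order optimality: moving \<open>x\<close> by \<open>e\<close> along the residual
  \<open>w = Ax - cx\<close> changes the form minus \<open>c\<close> times the squared norm by
  \<open>2e|w|\<^sup>2 - e\<^sup>2q\<close>, which is positive for small \<open>e > 0\<close> unless
  \<open>w = 0\<close>.\<close>

lemma rayleigh_maximizer_eigenvector:
  fixes A :: "real^'n^'n"
  assumes sym: "transpose A = A" and bound: "\<And>y. y \<bullet> (A *v y) \<le> c * (y \<bullet> y)"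
    and eq: "x \<bullet> (A *v x) = c * (x \<bullet> x)"
  shows "A *v x = c *\<^sub>R x"
proof -
  define w where "w = A *v x - c *\<^sub>R x"
  define q where "q = c * (w \<bullet> w) - w \<bullet> (A *v w)"
  have q0: "q \<ge> 0" using bound[of w] by (simp add: q_def)
  have key: "2 * e * (w \<bullet> w) \<le> e\<^sup>2 * q" for e
  proof -
    have "A *v (x + e *\<^sub>R w) = A *v x + e *\<^sub>R (A *v w)"
      by (simp add: matrix_vector_right_distrib scaleR_matrix_vector_assoc[symmetric] matrix_vector_mult_scaleR)
    then have "(x + e *\<^sub>R w) \<bullet> (A *v (x + e *\<^sub>R w)) - c * ((x + e *\<^sub>R w) \<bullet> (x + e *\<^sub>R w)) =
      (x \<bullet> (A *v x) - c * (x \<bullet> x)) + e * (x \<bullet> (A *v w) + w \<bullet> (A *v x) - 2 * c * (w \<bullet> x)) - e\<^sup>2 * q"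
      by (simp add: q_def inner_add_left inner_add_right inner_commute algebra_simps power2_eq_square)
    moreover have "x \<bullet> (A *v w) + w \<bullet> (A *v x) - 2 * c * (w \<bullet> x) = 2 * (w \<bullet> w)"
    proof -
      have "w \<bullet> w = w \<bullet> (A *v x) - c * (w \<bullet> x)"
        by (subst (2) w_def) (simp add: inner_diff_right)
      then show ?thesis
        using symmetric_inner_matrix[OF sym, of x w] by (simp add: inner_commute)
    qed
    ultimately show ?thesis using bound[of "x + e *\<^sub>R w"] eq by simp
  qed
  have "w \<bullet> w \<le> 0"
  proof (rule ccontr)
    assume "\<not> w \<bullet> w \<le> 0"
    then have pos: "w \<bullet> w > 0" by (simp only: not_le)
    \<comment> \<open>Small enough that \<open>e * q \<le> w \<bullet> w\<close>; the
      \<open>+ 1\<close> covers \<open>q = 0\<close>.\<close>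
    define e where "e = (w \<bullet> w) / (q + 1)"
    have "e > 0" using pos q0 by (simp add: e_def)
    have "2 * (w \<bullet> w) \<le> e * q"
      using key[of e] \<open>e > 0\<close> by (simp add: power2_eq_square)
    moreover have "e * q \<le> w \<bullet> w" using pos q0 by (simp add: e_def field_simps)
    ultimately show False using pos by linarith
  qed
  then have "w = 0" by (metis inner_eq_zero_iff inner_ge_zero order_antisym)
  then show ?thesis by (simp add: w_def)
qed

text \<open>By compactness the form attains its maximum on the unit sphere. The maximizer is an
  eigenvector, so the maximum is itself an eigenvalue.\<close>

lemma max_eigenvalue_symmetric:
  fixes A :: "real^'n^'n"
  assumes sym: "transpose A = A"
  shows "y \<bullet> (A *v y) \<le> Max (eigenvalues A) * (y \<bullet> y)"
proof -
  have "compact (sphere (0::real^'n) 1)" by simp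
  moreover have "sphere (0::real^'n) 1 \<noteq> {}" by simp
  moreover have "continuous_on (sphere (0::real^'n) 1) (\<lambda>x. x \<bullet> (A *v x))"
    by (intro continuous_intros matrix_vector_mult_linear_continuous_on)
  ultimately obtain x where x: "norm x = 1"
    and mx: "\<And>z. norm z = 1 \<Longrightarrow> z \<bullet> (A *v z) \<le> x \<bullet> (A *v x)"
    using continuous_attains_sup[of "sphere (0::real^'n) 1" "\<lambda>x. x \<bullet> (A *v x)"] by (auto simp: sphere_def)
  define c where "c = x \<bullet> (A *v x)"
  have bound: "z \<bullet> (A *v z) \<le> c * (z \<bullet> z)" for z
  proof (cases "z = 0")
    case False
    define u where "u = z /\<^sub>R norm z"
    have u: "norm u = 1" "z = norm z *\<^sub>R u" using False by (auto simp: u_def)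
    have "z \<bullet> (A *v z) = (norm z)\<^sup>2 * (u \<bullet> (A *v u))"
      by (subst (1 2) u(2)) (simp add: matrix_vector_mult_scaleR power2_eq_square)
    also have "\<dots> \<le> (norm z)\<^sup>2 * c" unfolding c_def by (intro mult_left_mono mx u) simp
    finally show ?thesis by (simp add: power2_norm_eq_inner mult.commute)
  qed simp
  have "A *v x = c *\<^sub>R x"
    using x by (intro rayleigh_maximizer_eigenvector[OF sym bound])
      (simp_all add: c_def power2_norm_eq_inner[symmetric])
  moreover have "x \<noteq> 0" using x by auto
  ultimately have "c \<in> eigenvalues A" by (auto simp: eigenvalues_def)
  then have "c \<le> Max (eigenvalues A)"
    using finite_eigenvalues_symmetric[OF sym] by simp
  then show ?thesis using bound[of y] by (meson inner_ge_zero mult_right_mono order_trans)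
qed

section \<open>Neighbourhoods, degrees and the adjacency matrix\<close>

definition neighbours :: "'v::finite set set \<Rightarrow> 'v set \<Rightarrow> 'v set" where
  "neighbours E X = {u. \<exists>v\<in>X. {u, v} \<in> E}"

lemma transpose_adjacency_matrix: "transpose (adjacency_matrix E) = adjacency_matrix E"
  by (simp add: vec_eq_iff transpose_def adjacency_matrix_def insert_commute)

lemma adjacency_matrix_vector_nth:
  "(adjacency_matrix E *v x) $ u = sum (($) x) {v. {u, v} \<in> E}"
  by (simp add: adjacency_matrix_def matrix_vector_mult_def if_distrib[of "\<lambda>a. a * _"]
      sum.If_cases Collect_conj_eq cong: if_cong)

lemmas lambda1_rayleigh =
  max_eigenvalue_symmetric[OF transpose_adjacency_matrix, folded lambda1_def]

lemma simple_graph_no_loop: "simple_graph E \<Longrightarrow> {v, v} \<notin> E"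
  by (force simp: simple_graph_def)

lemma degree_eq_card_neighbours:
  assumes "simple_graph E"
  shows "degree E v = card {u. {v, u} \<in> E}"
proof -
  have "bij_betw (\<lambda>u. {v, u}) {u. {v, u} \<in> E} (incident_edges E v)"
  proof (rule bij_betwI')
    fix e assume e: "e \<in> incident_edges E v"
    then have "card e = 2" "v \<in> e" using assms by (auto simp: simple_graph_def incident_edges_def)
    then obtain u where "e = {v, u}" by (auto simp: card_2_iff)
    then show "\<exists>u\<in>{u. {v, u} \<in> E}. e = {v, u}" using e by (auto simp: incident_edges_def)
  qed (auto simp: incident_edges_def doubleton_eq_iff)
  then show ?thesis by (simp add: degree_def bij_betw_same_card)
qed

lemma min_degree_le: "min_degree E \<le> degree E v"
  by (simp add: min_degree_def)

text \<open>The Rayleigh quotient of the all-ones vector is the average degree.\<close>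

lemma min_degree_le_lambda1:
  fixes E :: "'v::finite set set"
  assumes "simple_graph E"
  shows "real (min_degree E) \<le> lambda1 E"
proof -
  let ?x = "1 :: real^'v"
  have "real CARD('v) * real (min_degree E) \<le> (\<Sum>v\<in>(UNIV::'v set). real (degree E v))"
    using sum_mono[of "UNIV::'v set" "\<lambda>_. real (min_degree E)" "\<lambda>v. real (degree E v)"]
    by (simp add: min_degree_le)
  also have "\<dots> = ?x \<bullet> (adjacency_matrix E *v ?x)"
    by (simp add: inner_vec_def adjacency_matrix_vector_nth degree_eq_card_neighbours[OF assms])
  also have "\<dots> \<le> lambda1 E * real CARD('v)"
    using lambda1_rayleigh[of ?x E] by (simp add: inner_vec_def)
  finally show ?thesis by (simp add: mult.commute)
qed

section \<open>Fractional matchings, vertex covers and deficiency\<close>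

lemma sum_le_fractional_matching_number:
  assumes "fractional_matching E f"
  shows "sum f E \<le> fractional_matching_number E"
  unfolding fractional_matching_number_def
proof (rule cSUP_upper)
  have "sum g E \<le> real (card E)" if "fractional_matching E g" for g
    using that sum_bounded_above[of E g 1] by (auto simp: fractional_matching_def)
  then show "bdd_above ((\<lambda>f. sum f E) ` {f. fractional_matching E f})"
    by (auto intro!: bdd_aboveI)
qed (use assms in simp)

lemma fractional_matching_zero: "fractional_matching E (\<lambda>_. 0)"
  by (simp add: fractional_matching_def)

text \<open>Weak duality with vertex covers: summing the loads at the vertices of \<open>B\<close>
  counts every edge at least once, and each load is at most 1.\<close>

lemma fractional_matching_number_le_card_cover:
  fixes E :: "'v::finite set set"
  assumes "\<And>e. e \<in> E \<Longrightarrow> e \<inter> B \<noteq> {}"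
  shows "fractional_matching_number E \<le> real (card B)"
  unfolding fractional_matching_number_def
proof (rule cSUP_least)
  fix f assume "f \<in> {f. fractional_matching E f}"
  then have f0: "\<And>e. e \<in> E \<Longrightarrow> 0 \<le> f e" and f1: "\<And>v. sum f (incident_edges E v) \<le> 1"
    by (auto simp: fractional_matching_def)
  have "sum f E \<le> (\<Sum>e\<in>E. \<Sum>v\<in>B. if v \<in> e then f e else 0)"
  proof (rule sum_mono)
    fix e assume e: "e \<in> E"
    then obtain v where "v \<in> B" "v \<in> e" using assms by blast
    then show "f e \<le> (\<Sum>v\<in>B. if v \<in> e then f e else 0)"
      using member_le_sum[of v B "\<lambda>v. if v \<in> e then f e else 0"] f0[OF e] by auto
  qed
  also have "\<dots> = (\<Sum>v\<in>B. sum f (incident_edges E v))"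
    by (subst sum.swap) (simp add: incident_edges_def sum.inter_filter)
  also have "\<dots> \<le> real (card B)" using sum_bounded_above[of B "\<lambda>v. sum f (incident_edges E v)" 1] f1 by simp
  finally show "sum f E \<le> real (card B)" .
qed (use fractional_matching_zero in blast)

text \<open>A partial injection along edges is a matching of the bipartite double cover; putting half
  of it on each edge of \<open>E\<close> gives a fractional matching.\<close>
lemma half_card_injection_le_fractional_matching_number:
  fixes E :: "'v::finite set set"
  assumes simple: "simple_graph E" and inj: "inj_on h R" and edge: "\<And>r. r \<in> R \<Longrightarrow> {r, h r} \<in> E"
  shows "real (card R) / 2 \<le> fractional_matching_number E"
proof -
  \<comment> \<open>Summing over \<open>R\<close> counts multiplicity: an edge used in both
    directions gets weight 1.\<close>
  define f :: "'v set \<Rightarrow> real" where "f e = (\<Sum>r\<in>R. if e = {r, h r} then 1/2 else 0)" for e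
  have sumf: "sum f F = real (card {r \<in> R. {r, h r} \<in> F}) / 2" for F
  proof -
    have "sum f F = (\<Sum>r\<in>R. \<Sum>e\<in>F. if e = {r, h r} then 1/2 else 0)"
      unfolding f_def by (rule sum.swap)
    also have "\<dots> = (\<Sum>r\<in>R. if {r, h r} \<in> F then 1/2 else 0)"
      by simp
    also have "\<dots> = real (card {r \<in> R. {r, h r} \<in> F}) / 2"
      by (simp add: sum.If_cases Int_def)
    finally show ?thesis .
  qed
  have f0: "0 \<le> f e" for e by (simp add: f_def sum_nonneg)
  have fv: "sum f (incident_edges E v) \<le> 1" for v
  proof -
    \<comment> \<open>An edge \<open>{r, h r}\<close> at \<open>v\<close> has \<open>r = v\<close>
      or \<open>h r = v\<close>. Each happens for at most one \<open>r\<close>, so the load is at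
      most two halves.\<close>
    have "card {r \<in> R. {r, h r} \<in> incident_edges E v} \<le> card ({v} \<union> {r \<in> R. h r = v})"
      by (rule card_mono) (auto simp: incident_edges_def)
    also have "\<dots> \<le> card {v} + card {r \<in> R. h r = v}" by (rule card_Un_le)
    also have "card {r \<in> R. h r = v} \<le> 1"
      using inj by (auto simp: card_le_Suc0_iff_eq inj_on_def)
    finally show ?thesis by (simp add: sumf)
  qed
  have f1: "f e \<le> 1" if "e \<in> E" for e
  proof -
    have "card e = 2" using simple that by (simp add: simple_graph_def)
    then obtain v where "v \<in> e" by fastforce
    then have "f e \<le> sum f (incident_edges E v)"
      using that f0 by (intro member_le_sum) (auto simp: incident_edges_def)
    then show ?thesis using fv[of v] by linarith
  qed
  have "fractional_matching E f" using f0 f1 fv by (simp add: fractional_matching_def)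
  moreover have "{r \<in> R. {r, h r} \<in> E} = R" using edge by auto
  ultimately show ?thesis
    using sum_le_fractional_matching_number[of E f] by (simp add: sumf)
qed

lemma deficient_independent_set:
  fixes E :: "'v::finite set set"
  assumes "simple_graph E"
  obtains S T where "S \<inter> T = {}" and "neighbours E T \<subseteq> S" and "card S \<le> card T"
    and "(real CARD('v) - (real (card T) - real (card S))) / 2 \<le> fractional_matching_number E"
proof -
  \<comment> \<open>Subtraction truncates at 0, so \<open>\<delta> = 0\<close> need not come from a
    set with \<open>|N(X)| \<le> |X|\<close>; the empty set is then the witness.\<close>
  define \<delta> where "\<delta> = Max (range (\<lambda>X. card X - card (neighbours E X)))"
  have le: "card X - card (neighbours E X) \<le> \<delta>" for X unfolding \<delta>_def by (rule Max_ge) auto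
  have "\<exists>X. \<delta> = card X - card (neighbours E X) \<and> card (neighbours E X) \<le> card X"
  proof (cases "\<delta> = 0")
    case True
    then show ?thesis by (intro exI[of _ "{}"]) (simp add: neighbours_def)
  next
    case False
    have "\<delta> \<in> range (\<lambda>X. card X - card (neighbours E X))" unfolding \<delta>_def by (rule Max_in) auto
    then show ?thesis using False by auto
  qed
  then obtain X where X: "card X = card (neighbours E X) + \<delta>" by (metis le_add_diff_inverse)
  have U: "\<Union>((\<lambda>v. {u. {u, v} \<in> E}) ` J) = neighbours E J" for J by (auto simp: neighbours_def)
  have "\<exists>R h. finite R \<and> card (UNIV :: 'v set) \<le> card R + \<delta> \<and> inj_on h R \<and>
    (\<forall>r\<in>R. h r \<in> UNIV \<and> r \<in> {u. {u, h r} \<in> E})"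
    using le by (intro rado_deficiency) (auto simp: U add.commute le_diff_conv)
  then obtain R h where R: "CARD('v) \<le> card R + \<delta>" "inj_on h R" "\<And>r. r \<in> R \<Longrightarrow> {r, h r} \<in> E"
    by auto
  have m: "(real CARD('v) - real \<delta>) / 2 \<le> fractional_matching_number E"
    using half_card_injection_le_fractional_matching_number[OF assms R(2,3)] R(1) by auto
  \<comment> \<open>Both sets lose the same part \<open>X \<inter> N(X)\<close>, which preserves the
    difference of sizes. A vertex of \<open>T\<close> is outside \<open>N(X)\<close>, so it has no
    neighbour in \<open>X\<close>.\<close>
  define S where "S = neighbours E X - X"
  define T where "T = X - neighbours E X"
  have cX: "card X = card T + card (X \<inter> neighbours E X)"
    unfolding T_def by (metis card_Diff_subset_Int Int_lower1 card_mono finite le_add_diff_inverse2)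
  have cN: "card (neighbours E X) = card S + card (X \<inter> neighbours E X)"
    unfolding S_def by (metis card_Diff_subset_Int Int_commute Int_lower1 card_mono finite le_add_diff_inverse2)
  have TS: "card T = card S + \<delta>" using X cX cN by linarith
  show thesis
  proof (rule that[of S T])
    show "S \<inter> T = {}" by (auto simp: S_def T_def)
    show "neighbours E T \<subseteq> S"
    proof
      fix u assume "u \<in> neighbours E T"
      then obtain v where v: "v \<in> X" "v \<notin> neighbours E X" "{u, v} \<in> E"
        by (auto simp: T_def neighbours_def)
      have "{v, u} \<in> E" using v(3) by (simp add: insert_commute)
      then show "u \<in> S" using v by (auto simp: S_def neighbours_def)
    qed
    show "card S \<le> card T" using TS by simp
    show "(real CARD('v) - (real (card T) - real (card S))) / 2 \<le> fractional_matching_number E"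
      using m TS by simp
  qed
qed

section \<open>The spectral inequality and its equality case\<close>

text \<open>Both parts test the Rayleigh quotient with the vector that is \<open>d\<close> on \<open>T\<close> and \<open>\<lambda>\<^sub>1\<close> on \<open>S\<close>;
  in the equality case it must be an eigenvector.\<close>
lemma independent_set_lambda1:
  fixes E :: "'v::finite set set"
  assumes simple: "simple_graph E" and disj: "S \<inter> T = {}" and nb: "neighbours E T \<subseteq> S"
    and d: "d = min_degree E" and d0: "0 < d"
  shows "(real d)\<^sup>2 * real (card T) \<le> (lambda1 E)\<^sup>2 * real (card S)"
    and "\<lbrakk>(real d)\<^sup>2 * real (card T) = (lambda1 E)\<^sup>2 * real (card S); S \<union> T = UNIV\<rbrakk> \<Longrightarrow>
      bipartition E T S \<and> (\<forall>v\<in>T. degree E v = d) \<and> (\<forall>v\<in>S. real d * real (degree E v) = (lambda1 E)\<^sup>2)"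
proof -
  define L where "L = lambda1 E"
  define A where "A = adjacency_matrix E"
  have L: "L > 0" using min_degree_le_lambda1[OF simple] d d0 by (simp add: L_def)
  \<comment> \<open>The split isolates the cross term \<open>y \<bullet> (A *v z)\<close>, which
    counts the edges between \<open>T\<close> and \<open>S\<close>; the other two terms need only be
    nonnegative.\<close>
  define y z where "y = (\<chi> v. if v \<in> T then real d else 0)" and "z = (\<chi> v. if v \<in> S then L else 0)"
  have nonneg: "0 \<le> y $ v" "0 \<le> z $ v" for v using L by (auto simp: y_def z_def)
  have A_nonneg: "0 \<le> (A *v y) $ v" "0 \<le> (A *v z) $ v" for v
    unfolding A_def adjacency_matrix_vector_nth by (auto intro!: sum_nonneg nonneg)
  have nbT: "{v. {u, v} \<in> E} \<subseteq> S" if "u \<in> T" for u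
    using nb that by (auto simp: neighbours_def insert_commute)
  have Az: "(A *v z) $ u = L * real (degree E u)" if "u \<in> T" for u
  proof -
    have "(A *v z) $ u = (\<Sum>v\<in>{v. {u, v} \<in> E}. L)"
      unfolding A_def adjacency_matrix_vector_nth
      using nbT[OF that] by (intro sum.cong) (auto simp: z_def)
    then show ?thesis by (simp add: degree_eq_card_neighbours[OF simple])
  qed
  have yAz: "y \<bullet> (A *v z) = (\<Sum>u\<in>T. real d * L * real (degree E u))"
  proof -
    have "y \<bullet> (A *v z) = (\<Sum>u\<in>UNIV. if u \<in> T then real d * (A *v z) $ u else 0)"
      by (auto simp: inner_vec_def y_def intro!: sum.cong)
    also have "\<dots> = (\<Sum>u\<in>T. real d * (A *v z) $ u)" by (simp add: sum.If_cases)
    also have "\<dots> = (\<Sum>u\<in>T. real d * L * real (degree E u))" by (simp add: Az mult.assoc)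
    finally show ?thesis .
  qed
  have deg: "real d * L * real d * real (card T) \<le> y \<bullet> (A *v z)"
  proof -
    have "(\<Sum>u\<in>T. real d * L * real d) \<le> y \<bullet> (A *v z)"
      unfolding yAz using min_degree_le[of E] L by (intro sum_mono mult_left_mono) (auto simp: d)
    then show ?thesis by (simp add: mult.commute)
  qed
  have yAy: "0 \<le> y \<bullet> (A *v y)" and zAz: "0 \<le> z \<bullet> (A *v z)"
    unfolding inner_vec_def by (auto intro!: sum_nonneg mult_nonneg_nonneg nonneg A_nonneg)
  have "z \<bullet> (A *v y) = y \<bullet> (A *v z)"
    unfolding A_def by (subst symmetric_inner_matrix[OF transpose_adjacency_matrix]) (rule inner_commute)
  then have quad: "(y + z) \<bullet> (A *v (y + z)) = y \<bullet> (A *v y) + 2 * (y \<bullet> (A *v z)) + z \<bullet> (A *v z)"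
    by (simp add: matrix_vector_right_distrib inner_add_left inner_add_right)
  have "(y + z) \<bullet> (y + z) = (\<Sum>v\<in>UNIV. (if v \<in> T then (real d)\<^sup>2 else 0) + (if v \<in> S then L\<^sup>2 else 0))"
    unfolding inner_vec_def using disj by (intro sum.cong) (auto simp: y_def z_def power2_eq_square)
  then have norm: "(y + z) \<bullet> (y + z) = (real d)\<^sup>2 * real (card T) + L\<^sup>2 * real (card S)"
    by (simp add: sum.distrib sum.If_cases mult.commute)
  have ray: "(y + z) \<bullet> (A *v (y + z)) \<le> L * ((y + z) \<bullet> (y + z))"
    unfolding A_def L_def by (rule lambda1_rayleigh)
  have "L * (2 * ((real d)\<^sup>2 * real (card T))) \<le> L * ((real d)\<^sup>2 * real (card T) + L\<^sup>2 * real (card S))"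
  proof -
    have "L * (2 * ((real d)\<^sup>2 * real (card T))) = 2 * (real d * L * real d * real (card T))"
      by (simp add: power2_eq_square)
    also have "\<dots> \<le> (y + z) \<bullet> (A *v (y + z))" using deg yAy zAz quad by linarith
    finally show ?thesis using ray unfolding norm by linarith
  qed
  then have "(real d)\<^sup>2 * real (card T) \<le> L\<^sup>2 * real (card S)" using L by (simp add: mult.commute)
  then show "(real d)\<^sup>2 * real (card T) \<le> (lambda1 E)\<^sup>2 * real (card S)" by (simp add: L_def)
  assume eq: "(real d)\<^sup>2 * real (card T) = (lambda1 E)\<^sup>2 * real (card S)" and UN: "S \<union> T = UNIV"
  have norm': "L * ((y + z) \<bullet> (y + z)) = 2 * (real d * L * real d * real (card T))"
    using eq unfolding norm L_def by (simp add: power2_eq_square algebra_simps)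
  \<comment> \<open>Under equality the lower bound from the cross term meets the Rayleigh upper
    bound, so all intermediate estimates are equalities.\<close>
  have qeq: "(y + z) \<bullet> (A *v (y + z)) = L * ((y + z) \<bullet> (y + z))" and zAz0: "z \<bullet> (A *v z) = 0"
    using deg yAy zAz quad ray norm' by linarith+
  have eig: "A *v (y + z) = L *\<^sub>R (y + z)"
    using transpose_adjacency_matrix lambda1_rayleigh qeq
    unfolding A_def L_def by (rule rayleigh_maximizer_eigenvector)
  have indep: "{u, v} \<notin> E" if "u \<in> S" "v \<in> S" for u v
  proof
    assume e: "{u, v} \<in> E"
    \<comment> \<open>A vanishing sum of nonnegative terms vanishes termwise, whereas an edge inside
      \<open>S\<close> would contribute a positive term.\<close>
    have "z $ u * (A *v z) $ u = 0"
      using zAz0 unfolding inner_vec_def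
      by (subst (asm) sum_nonneg_eq_0_iff) (auto intro!: mult_nonneg_nonneg nonneg A_nonneg)
    then have "(A *v z) $ u = 0" using that L by (simp add: z_def)
    then have "z $ v = 0" using e unfolding A_def adjacency_matrix_vector_nth
      by (subst (asm) sum_nonneg_eq_0_iff) (auto intro: nonneg)
    then show False using that L by (simp add: z_def)
  qed
  have nbS: "{v. {u, v} \<in> E} \<subseteq> T" if "u \<in> S" for u using indep[OF that] UN by auto
  have "degree E v = d" if "v \<in> T" for v
  proof -
    \<comment> \<open>The eigenvector equation at \<open>v\<close> in \<open>T\<close>, whose
      neighbours all carry the value \<open>L\<close>, reads \<open>L * degree E v = L * d\<close>.
      At \<open>v\<close> in \<open>S\<close> it will read
      \<open>d * degree E v = L * L\<close>.\<close>
    have "(\<Sum>u\<in>{u. {v, u} \<in> E}. (y + z) $ u) = (\<Sum>u\<in>{u. {v, u} \<in> E}. L)"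
      using nbT[OF that] disj by (intro sum.cong) (auto simp: y_def z_def)
    moreover have "(A *v (y + z)) $ v = L * d"
      using that disj unfolding eig by (auto simp: y_def z_def)
    ultimately show ?thesis
      using L by (simp add: A_def adjacency_matrix_vector_nth degree_eq_card_neighbours[OF simple])
  qed
  moreover have "real d * real (degree E v) = (lambda1 E)\<^sup>2" if "v \<in> S" for v
  proof -
    have "(\<Sum>u\<in>{u. {v, u} \<in> E}. (y + z) $ u) = (\<Sum>u\<in>{u. {v, u} \<in> E}. real d)"
      using nbS[OF that] disj by (intro sum.cong) (auto simp: y_def z_def)
    moreover have "(A *v (y + z)) $ v = L * L"
      using that disj unfolding eig by (auto simp: y_def z_def)
    ultimately show ?thesis
      by (simp add: A_def adjacency_matrix_vector_nth degree_eq_card_neighbours[OF simple] L_def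
          power2_eq_square mult.commute)
  qed
  moreover have "\<exists>a\<in>T. \<exists>b\<in>S. e = {a, b}" if "e \<in> E" for e
  proof -
    have "card e = 2" using simple that by (simp add: simple_graph_def)
    then obtain u v where e: "e = {u, v}" by (auto simp: card_2_iff)
    have "\<not> (u \<in> S \<and> v \<in> S)" using indep that e by blast
    moreover have "\<not> (u \<in> T \<and> v \<in> T)" using nbT[of u] that e disj by auto
    ultimately show ?thesis using UN e by (metis UNIV_I UnE insert_commute)
  qed
  ultimately show "bipartition E T S \<and> (\<forall>v\<in>T. degree E v = d) \<and>
      (\<forall>v\<in>S. real d * real (degree E v) = (lambda1 E)\<^sup>2)"
    using UN disj by (auto simp: bipartition_def)
qed

section \<open>The degenerate case, the final algebra and the theorem\<close>

text \<open>A connected graph with an isolated vertex is a single vertex. For \<open>d = 0\<close>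
  this forces \<open>k = 0\<close>, as division by zero yields 0, so the equality claim is
  vacuous.\<close>

lemma lambda1_eq_0_if_isolated:
  fixes E :: "'v::finite set set"
  assumes "simple_graph E" and "graph_connected E" and "min_degree E = 0"
  shows "lambda1 E = 0"
proof -
  have "min_degree E \<in> range (degree E)" unfolding min_degree_def by (rule Min_in) auto
  then obtain v where "degree E v = 0" using assms by auto
  then have v: "{v, u} \<notin> E" for u by (auto simp: degree_def incident_edges_def)
  have "u = v" for u
    using assms(2)[unfolded graph_connected_def, rule_format, of v u] v
    by (auto elim: converse_rtranclE)
  then have "a = b" for a b :: 'v by metis
  then have "{a, b} \<notin> E" for a b using simple_graph_no_loop[OF assms(1)] by metis
  then have "adjacency_matrix E = 0" by (simp add: adjacency_matrix_def vec_eq_iff)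
  moreover have "\<exists>x::real^'v. x \<noteq> 0" by (rule exI[of _ 1]) simp
  ultimately have "eigenvalues (adjacency_matrix E) = {0}" by (auto simp: eigenvalues_def)
  then show ?thesis by (simp add: lambda1_def)
qed

text \<open>The algebra behind the bound and its equality case, with \<open>l = \<lambda>\<^sub>1\<^sup>2\<close>, \<open>D = d\<^sup>2\<close>, \<open>s = |S|\<close>, \<open>t = |T|\<close>.\<close>
lemma deficiency_bound:
  fixes n s t l D :: real
  assumes "0 < D" and "D \<le> l" and "s + t \<le> n" and "D * t \<le> l * s"
  shows "n * D / (l + D) \<le> (n - (t - s)) / 2"
    and "\<lbrakk>n * D / (l + D) = (n - (t - s)) / 2; D < l\<rbrakk> \<Longrightarrow> s + t = n \<and> D * t = l * s"
proof -
  \<comment> \<open>With denominators cleared, the gap splits into two nonnegative slacks: vertices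
    outside \<open>S \<union> T\<close>, and the spectral inequality. A zero gap kills both;
    \<open>D < l\<close> then cancels the factor \<open>l - D\<close>.\<close>
  have id: "(n - (t - s)) * (l + D) - 2 * (n * D) = (l - D) * (n - (s + t)) + 2 * (l * s - D * t)"
    by (simp add: algebra_simps)
  have nonneg: "0 \<le> (l - D) * (n - (s + t))" using assms by simp
  have "0 \<le> (n - (t - s)) * (l + D) - 2 * (n * D)" unfolding id using nonneg assms by simp
  then have "2 * (n * D) \<le> (n - (t - s)) * (l + D)" by simp
  then show "n * D / (l + D) \<le> (n - (t - s)) / 2" using assms by (simp add: field_simps)
  assume eq: "n * D / (l + D) = (n - (t - s)) / 2" and lt: "D < l"
  have "2 * (n * D) = (n - (t - s)) * (l + D)" using eq assms by (simp add: field_simps)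
  then have "(l - D) * (n - (s + t)) + 2 * (l * s - D * t) = 0" using id by simp
  then have "(l - D) * (n - (s + t)) = 0" "l * s - D * t = 0"
    using nonneg assms(4) by (simp_all add: add_nonneg_eq_0_iff)
  then show "s + t = n \<and> D * t = l * s" using lt by auto
qed

theorem theorem3p3:
  fixes E :: "'v::finite set set" and n d :: nat and k :: real
  assumes "simple_graph E"
    and "n = CARD('v)"
    and "min_degree E = d"
    and "k = real n * ((lambda1 E)\<^sup>2 - (real d)\<^sup>2) / ((lambda1 E)\<^sup>2 + (real d)\<^sup>2)"
  shows "fractional_matching_number E \<ge> real n * (real d)\<^sup>2 / ((lambda1 E)\<^sup>2 + (real d)\<^sup>2) \<and>
    (graph_connected E \<longrightarrow> k \<noteq> 0 \<longrightarrow>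
      (fractional_matching_number E = real n * (real d)\<^sup>2 / ((lambda1 E)\<^sup>2 + (real d)\<^sup>2) \<longleftrightarrow>
        (\<exists>m::nat. k = real m \<and> E \<in> H_family d m)))"
proof (cases "d = 0")
  case True
  have "0 \<le> fractional_matching_number E"
    using sum_le_fractional_matching_number[OF fractional_matching_zero, of E] by simp
  then show ?thesis
    using True lambda1_eq_0_if_isolated[of E] assms by auto
next
  case False
  then have D: "0 < (real d)\<^sup>2" by simp
  have l: "(real d)\<^sup>2 \<le> (lambda1 E)\<^sup>2"
    using min_degree_le_lambda1[OF assms(1)] assms(3) by (intro power_mono) auto
  have denom: "(lambda1 E)\<^sup>2 + (real d)\<^sup>2 > 0" using D l by linarith
  \<comment> \<open>In this form, comparison with \<open>(n - (|T| - |S|)) / 2\<close> identifies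
    \<open>k\<close> as \<open>|T| - |S|\<close> in the equality case.\<close>
  have bound_k: "real n * (real d)\<^sup>2 / ((lambda1 E)\<^sup>2 + (real d)\<^sup>2) = (real n - k) / 2"
    using less_imp_neq[OF denom] unfolding assms(4) by (simp add: divide_simps) (simp add: algebra_simps)
  obtain S T where disj: "S \<inter> T = {}" and nb: "neighbours E T \<subseteq> S" and le: "card S \<le> card T"
    and mat: "(real n - (real (card T) - real (card S))) / 2 \<le> fractional_matching_number E"
    using deficient_independent_set[OF assms(1)] unfolding assms(2) by metis
  note ST = independent_set_lambda1[OF assms(1) disj nb assms(3)[symmetric]]
  have "card S + card T \<le> n"
    unfolding assms(2) using disj by (metis card_Un_disjoint card_mono finite subset_UNIV)
  then have st: "real (card S) + real (card T) \<le> real n" by linarith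
  have edges: "(real d)\<^sup>2 * real (card T) \<le> (lambda1 E)\<^sup>2 * real (card S)" using ST(1) False by simp
  note bound = deficiency_bound[OF D l st edges]
  have ge: "real n * (real d)\<^sup>2 / ((lambda1 E)\<^sup>2 + (real d)\<^sup>2) \<le> fractional_matching_number E"
    using bound(1) mat by linarith
  have "\<exists>m::nat. k = real m \<and> E \<in> H_family d m"
    if conn: "graph_connected E" and k: "k \<noteq> 0"
      and eq: "fractional_matching_number E = real n * (real d)\<^sup>2 / ((lambda1 E)\<^sup>2 + (real d)\<^sup>2)"
  proof -
    \<comment> \<open>\<open>k \<noteq> 0\<close> rules out
      \<open>\<lambda>\<^sub>1\<^sup>2 = d\<^sup>2\<close>, where the bound is \<open>n / 2\<close>
      and would not force \<open>S\<close> and \<open>T\<close> to cover the graph.\<close>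
    have lt: "(real d)\<^sup>2 < (lambda1 E)\<^sup>2" using k l unfolding assms(4) by (cases "(real d)\<^sup>2 = (lambda1 E)\<^sup>2") auto
    have eq': "real n * (real d)\<^sup>2 / ((lambda1 E)\<^sup>2 + (real d)\<^sup>2) = (real n - (real (card T) - real (card S))) / 2"
      using bound(1) mat eq by linarith
    have tight: "real (card S) + real (card T) = real n"
      "(real d)\<^sup>2 * real (card T) = (lambda1 E)\<^sup>2 * real (card S)"
      using bound(2)[OF eq' lt] by auto
    have "card (S \<union> T) = CARD('v)" using tight(1) disj assms(2) by (simp add: card_Un_disjoint)
    then have UN: "S \<union> T = UNIV" by (simp add: card_eq_UNIV_imp_eq_UNIV)
    have H: "bipartition E T S" "\<forall>v\<in>T. degree E v = d"
      "\<forall>v\<in>S. real d * real (degree E v) = (lambda1 E)\<^sup>2"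
      using ST(2)[OF _ tight(2) UN] False by auto
    have reg: "\<exists>r. \<forall>v\<in>S. degree E v = r"
    proof (cases "S = {}")
      case nonempty: False
      then obtain w where "w \<in> S" by blast
      then have "degree E v = degree E w" if "v \<in> S" for v
        using H(3) that False by (metis mult_left_cancel of_nat_eq_0_iff of_nat_eq_iff)
      then show ?thesis by blast
    qed simp
    have km: "k = real (card T - card S)" using eq' bound_k le by (simp add: of_nat_diff)
    then have "E \<in> H_family d (card T - card S)"
      using k False assms(1) conn H reg le
      unfolding H_family_def mem_Collect_eq by (intro conjI exI[of _ T] exI[of _ S]) auto
    with km show ?thesis by blast
  qed
  moreover have "fractional_matching_number E = real n * (real d)\<^sup>2 / ((lambda1 E)\<^sup>2 + (real d)\<^sup>2)"
    if k: "k = real m" and H: "E \<in> H_family d m" for m :: nat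
  proof -
    obtain A B where AB: "bipartition E A B" "card A = card B + m"
      using H by (auto simp: H_family_def)
    have "card (A \<union> B) = card A + card B"
      using AB(1) by (intro card_Un_disjoint) (auto simp: bipartition_def)
    then have "n = 2 * card B + m" using AB by (simp add: assms(2) bipartition_def)
    then have "(real n - k) / 2 = real (card B)" by (simp add: k)
    moreover have "fractional_matching_number E \<le> real (card B)"
      using AB(1) by (intro fractional_matching_number_le_card_cover) (auto simp: bipartition_def)
    ultimately show ?thesis using ge bound_k by linarith
  qed
  ultimately show ?thesis using ge by blast
qed

end
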